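(* Let $p$ be an odd prime with $p \geq 5$ and $p \equiv 5 \pmod{12}$ or $p \equiv 7 \pmod{12}$. Then there exist no $p$ positive integers which are consecutive terms of an arithmetic progression and whose sum of squares is a perfect square. Equivalently, if $a_1, a_2, \ldots, a_p$ are positive integers which are consecutive terms of an arithmetic progression, then there is no integer $t$ with $a_1^2 + a_2^2 + \cdots + a_p^2 = t^2$.
   Context: Integers $a_1, \ldots, a_p$ are consecutive terms of an arithmetic progression if there is an integer $d$ (the common difference) such that $a_i = a_1 + (i-1)d$ for $i = 1, \ldots, p$; increasing, decreasing and constant progressions are all allowed. A perfect square is the square of an integer. *)

theory Defs
  imports "HOL-Number_Theory.Number_Theory" "HOL-Computational_Algebra.Nth_Powers"
begin

(* The terms are a 1, ..., a p; the values of a outside {1..p} play no role. *)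
definition consecutive_ap_terms :: "nat \<Rightarrow> (nat \<Rightarrow> int) \<Rightarrow> bool" where
  "consecutive_ap_terms p a \<longleftrightarrow> (\<exists>d::int. \<forall>i\<in>{1..p}. a i = a 1 + (int i - 1) * d)"

end

theory Submission
  imports Defs
begin

text \<open>
  Let \<open>d\<close> be the common difference and \<open>M = a\<^sub>1 + a\<^sub>p\<close>, which is twice the mean of the progression.
  Splitting a sum of squares into its mean part and its variance part gives
  \[ 12 (a_1^2 + \cdots + a_p^2) = p\,(3 M^2 + (p^2 - 1) d^2). \]
  If the sum is a square \<open>t\<^sup>2\<close>, then \<open>p\<close> divides \<open>t\<close>, and with \<open>t = p s\<close> one factor \<open>p\<close> cancels:
  \[ 3 M^2 + (p^2 - 1) d^2 = 12 p s^2. \]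
  Modulo \<open>p\<close> this reads \<open>d\<^sup>2 \<equiv> 3 M\<^sup>2\<close>. Quadratic reciprocity makes 3 a quadratic non-residue
  of each prime \<open>p \<equiv> 5, 7 (mod 12)\<close> (\<open>three_not_QuadRes\<close>), so \<open>p\<close> divides both \<open>d\<close> and \<open>M\<close>, and
  then also \<open>s\<close>. Hence \<open>(M/p, d/p, s/p)\<close> is again an integer solution, and infinite descent
  (\<open>descent_eq_zero\<close>) forces \<open>M = 0\<close>. This is impossible when all terms are positive.
\<close>

text \<open>By reciprocity, the Legendre symbol of 3 modulo \<open>p\<close> is that of \<open>p\<close> modulo 3 times the sign
  \<open>(-1)\<^sup>k\<close> with \<open>k = (p - 1) / 2\<close>. For \<open>p \<equiv> 5\<close> the symbol is \<open>-1\<close> and the sign 1; for \<open>p \<equiv> 7\<close>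
  it is the other way round.\<close>

lemma three_not_QuadRes:
  fixes p :: nat
  assumes p: "prime p" and mod12: "[p = 5] (mod 12) \<or> [p = 7] (mod 12)"
  shows "\<not> QuadRes (int p) 3"
proof -
  have pm: "p mod 12 = 5 \<or> p mod 12 = 7"
    using mod12 by (simp add: cong_def)
  have "p \<ge> 5"
    using pm by presburger
  then have rec: "Legendre (int p) 3 * Legendre 3 (int p) = (- 1) ^ ((p - 1) div 2)"
    using Quadratic_Reciprocity[of p 3] p by simp
  have square_mod_3: "y\<^sup>2 mod 3 \<noteq> 2" for y :: int
  proof -
    have "y mod 3 = 0 \<or> y mod 3 = 1 \<or> y mod 3 = 2" by presburger
    then have "(y mod 3)\<^sup>2 mod 3 \<noteq> 2" by auto
    then show ?thesis by (simp add: power_mod)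
  qed
  have "Legendre 3 (int p) = - 1"
    using pm
  proof
    assume r: "p mod 12 = 5"
    have "int p mod 3 = 2" using r by presburger
    then have "Legendre (int p) 3 = - 1"
      using square_mod_3 by (simp add: Legendre_def QuadRes_def cong_def)
    moreover have "even ((p - 1) div 2)" using r by presburger
    ultimately show ?thesis using rec by simp
  next
    assume r: "p mod 12 = 7"
    have "int p mod 3 = 1" using r by presburger
    then have "Legendre (int p) 3 = 1"
      by (auto simp: Legendre_def QuadRes_def cong_def intro: exI[of _ 1])
    moreover have "odd ((p - 1) div 2)" using r by presburger
    ultimately show ?thesis using rec by simp
  qed
  then show ?thesis
    by (auto simp: Legendre_def split: if_splits)
qed

text \<open>If \<open>p\<close> did not divide \<open>y\<close>, then \<open>x/y\<close> would be a square root of \<open>c\<close> modulo \<open>p\<close>.\<close>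

lemma nonresidue_form_dvd:
  fixes p c x y :: int
  assumes p: "prime p" and nonres: "\<not> QuadRes p c" and xy: "[x\<^sup>2 = c * y\<^sup>2] (mod p)"
  shows "p dvd x \<and> p dvd y"
proof -
  have y: "p dvd y"
  proof (rule ccontr)
    assume "\<not> p dvd y"
    then have "coprime y p"
      using p by (metis coprime_commute prime_imp_coprime)
    then obtain z where z: "[y * z = 1] (mod p)"
      using cong_solve_coprime_int by blast
    have "[(x * z)\<^sup>2 = c * (y * z)\<^sup>2] (mod p)"
      using cong_mult[OF xy cong_refl[of "z\<^sup>2"]] by (simp add: power_mult_distrib algebra_simps)
    also have "[c * (y * z)\<^sup>2 = c * 1\<^sup>2] (mod p)"
      by (intro cong_mult cong_pow cong_refl z)
    finally show False
      using nonres by (auto simp: QuadRes_def)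
  qed
  then have "p dvd c * y\<^sup>2"
    by (simp add: power2_eq_square)
  then have "p dvd x\<^sup>2"
    using xy cong_dvd_iff by blast
  then show ?thesis
    using y p prime_dvd_power by blast
qed

lemma dvd_of_dvd_12_mult_square:
  fixes p x :: int
  assumes p: "prime p" and p5: "p \<ge> 5" and dvd: "p dvd 12 * x\<^sup>2"
  shows "p dvd x"
proof -
  have "\<not> p dvd 2" "\<not> p dvd 3"
    using p5 zdvd_imp_le[of p 2] zdvd_imp_le[of p 3] by auto
  then have "\<not> p dvd 2 * (2 * 3)"
    using p by (simp only: prime_dvd_mult_iff) blast
  then show ?thesis
    using p dvd prime_dvd_mult_iff[OF p] prime_dvd_power[OF p] by auto
qed

text \<open>An integer solution stays integral after division by \<open>p\<close>, so \<open>M\<close> would be divisible by all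
  powers of \<open>p\<close> and can only be 0.\<close>

lemma descent_eq_zero:
  fixes p M d s :: int
  assumes p: "prime p" and p5: "p \<ge> 5" and nonres: "\<not> QuadRes p 3"
    and eq: "3 * M\<^sup>2 + (p\<^sup>2 - 1) * d\<^sup>2 = 12 * p * s\<^sup>2"
  shows "M = 0"
  using eq
proof (induction "nat \<bar>M\<bar>" arbitrary: M d s rule: less_induct)
  case less
  have "d\<^sup>2 - 3 * M\<^sup>2 = p * (p * d\<^sup>2 - 12 * s\<^sup>2)"
    using less.prems by (simp add: algebra_simps power2_eq_square)
  then have "[d\<^sup>2 = 3 * M\<^sup>2] (mod p)"
    by (simp add: cong_iff_dvd_diff)
  then have "p dvd d" "p dvd M"
    using nonresidue_form_dvd[OF p nonres] by blast+
  then obtain d' M' where d': "d = p * d'" and M': "M = p * M'"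
    by (auto elim!: dvdE)
  have "p * (12 * s\<^sup>2) = p * (p * (3 * M'\<^sup>2 + (p\<^sup>2 - 1) * d'\<^sup>2))"
    using less.prems by (simp add: d' M' algebra_simps power2_eq_square)
  then have cancelled: "12 * s\<^sup>2 = p * (3 * M'\<^sup>2 + (p\<^sup>2 - 1) * d'\<^sup>2)"
    using p5 by simp
  then have "p dvd s"
    using dvd_of_dvd_12_mult_square[OF p p5] by simp
  then obtain s' where s': "s = p * s'" ..
  have "p * (3 * M'\<^sup>2 + (p\<^sup>2 - 1) * d'\<^sup>2) = p * (12 * p * s'\<^sup>2)"
    using cancelled by (simp add: s' power2_eq_square algebra_simps)
  then have solution: "3 * M'\<^sup>2 + (p\<^sup>2 - 1) * d'\<^sup>2 = 12 * p * s'\<^sup>2"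
    using p5 by simp
  show ?case
  proof (rule ccontr)
    assume "M \<noteq> 0"
    then have "M' \<noteq> 0" by (simp add: M')
    then have "1 * \<bar>M'\<bar> < p * \<bar>M'\<bar>"
      using p5 by (intro mult_strict_right_mono) auto
    then have "nat \<bar>M'\<bar> < nat \<bar>M\<bar>"
      using p5 by (simp add: M' abs_mult)
    then show False
      using less.hyps solution \<open>M' \<noteq> 0\<close> by blast
  qed
qed

text \<open>The factor 12 clears the denominators of the mean \<open>A + (n - 1) d / 2\<close> and of the variance
  \<open>(n\<^sup>2 - 1) d\<^sup>2 / 12\<close>, so that the identity holds over the integers for \<open>n\<close> of either parity.\<close>

lemma sum_squares_ap:
  fixes A d :: int
  shows "12 * (\<Sum>i = 1..n. (A + (int i - 1) * d)\<^sup>2) =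
         int n * (3 * (2 * A + (int n - 1) * d)\<^sup>2 + ((int n)\<^sup>2 - 1) * d\<^sup>2)"
  by (induction n) (simp_all add: algebra_simps power2_eq_square)

theorem theorem3:
  fixes p :: nat
  assumes "prime p" and "odd p" and "p \<ge> 5"
    and "[p = 5] (mod 12) \<or> [p = 7] (mod 12)"
  shows "\<not> (\<exists>a :: nat \<Rightarrow> int. (\<forall>i\<in>{1..p}. a i > 0) \<and> consecutive_ap_terms p a \<and>
           is_square (\<Sum>i = 1..p. (a i)\<^sup>2))"
proof
  assume "\<exists>a :: nat \<Rightarrow> int. (\<forall>i\<in>{1..p}. a i > 0) \<and> consecutive_ap_terms p a \<and>
           is_square (\<Sum>i = 1..p. (a i)\<^sup>2)"
  then obtain a :: "nat \<Rightarrow> int" and d t :: int where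
    pos: "\<forall>i\<in>{1..p}. a i > 0" and
    ap: "\<And>i. i \<in> {1..p} \<Longrightarrow> a i = a 1 + (int i - 1) * d" and
    t: "(\<Sum>i = 1..p. (a i)\<^sup>2) = t\<^sup>2"
    unfolding consecutive_ap_terms_def is_nth_power_def by blast
  have p: "prime (int p)" and p5: "int p \<ge> 5"
    using assms by auto
  define M where "M = 2 * a 1 + (int p - 1) * d"
  have "M = a 1 + a p"
    using ap[of p] assms(3) by (simp add: M_def)
  then have "M > 0"
    using pos assms(3) by (simp add: add_pos_pos)
  have "(\<Sum>i = 1..p. (a i)\<^sup>2) = (\<Sum>i = 1..p. (a 1 + (int i - 1) * d)\<^sup>2)"
    by (intro sum.cong refl) (metis ap)
  then have eq: "12 * t\<^sup>2 = int p * (3 * M\<^sup>2 + ((int p)\<^sup>2 - 1) * d\<^sup>2)"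
    using sum_squares_ap[where n = p and A = "a 1" and d = d] t by (simp add: M_def)
  then have "int p dvd t"
    using dvd_of_dvd_12_mult_square[OF p p5] by simp
  then obtain s where "t = int p * s" ..
  then have "int p * (3 * M\<^sup>2 + ((int p)\<^sup>2 - 1) * d\<^sup>2) = int p * (12 * int p * s\<^sup>2)"
    using eq by (simp add: power2_eq_square algebra_simps)
  then have "3 * M\<^sup>2 + ((int p)\<^sup>2 - 1) * d\<^sup>2 = 12 * int p * s\<^sup>2"
    using p5 by simp
  then have "M = 0"
    using descent_eq_zero[OF p p5] three_not_QuadRes assms by blast
  then show False
    using \<open>M > 0\<close> by simp
qed

end
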